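(* Let $A$ be a finite subset of $\mathbb{Z}$ containing at least two points. Then the smallest possible size of a percolating seed $S \subseteq \mathbb{Z}$ for the collection of patterns $\{A\}$ in dimension $d = 1$ equals $\operatorname{vol}(\operatorname{conv} A)$, the length of the convex hull of $A$ (that is, $\max A - \min A$).
   Context: Let $d$ be a positive integer and let $\mathcal{A}$ be a finite collection of finite subsets of $\mathbb{Z}^d$, called patterns. A seed is any subset $S$ of $\mathbb{Z}^d$, finite or infinite. Consider the following process. At each moment, every point of $\mathbb{Z}^d$ is either occupied or vacant; initially exactly the points of $S$ are occupied. A point completes a subset of $\mathbb{Z}^d$ if it is the unique vacant point in that subset. On each step, all vacant points which complete a translation copy (by a vector of $\mathbb{Z}^d$) of some pattern in $\mathcal{A}$ become occupied simultaneously; once a point is occupied it stays occupied. The seed $S$ percolates (is a percolating seed for $\mathcal{A}$) if every point of $\mathbb{Z}^d$ eventually becomes occupied. $\operatorname{conv} A$ denotes the convex hull in $\mathbb{R}^d$ and $\operatorname{vol}$ denotes $d$-dimensional volume. *)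

theory Defs
  imports "HOL-Analysis.Analysis"
begin

text \<open>
  The process makes sense in any abelian group; the lattice \<open>\<int>\<^sup>d\<close> is the instance
  \<^typ>\<open>int ^ 'd\<close>, or simply \<^typ>\<open>int\<close> when \<open>d = 1\<close>.
\<close>

definition completes :: "'a set \<Rightarrow> 'a \<Rightarrow> 'a set \<Rightarrow> bool" where
  "completes X x U \<longleftrightarrow> x \<in> U \<and> x \<notin> X \<and> (\<forall>y\<in>U. y \<notin> X \<longrightarrow> y = x)"

definition perc_step :: "'a::ab_group_add set set \<Rightarrow> 'a set \<Rightarrow> 'a set" where
  "perc_step \<A> X = X \<union> {x. \<exists>A\<in>\<A>. \<exists>v. completes X x ((\<lambda>a. a + v) ` A)}"

definition occupied :: "'a::ab_group_add set set \<Rightarrow> 'a set \<Rightarrow> nat \<Rightarrow> 'a set" where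
  "occupied \<A> S n = (perc_step \<A> ^^ n) S"

definition percolates :: "'a::ab_group_add set set \<Rightarrow> 'a set \<Rightarrow> bool" where
  "percolates \<A> S \<longleftrightarrow> (\<forall>x. \<exists>n. x \<in> occupied \<A> S n)"

text \<open>
  Seeds may be infinite, but an infinite seed never has size \<open>n\<close>, nor is it smaller than a finite
  one; \<^const>\<open>finite\<close> is stated explicitly because \<^const>\<open>card\<close> is \<open>0\<close> on infinite sets.
\<close>

definition min_percolating_size :: "'a::ab_group_add set set \<Rightarrow> nat \<Rightarrow> bool" where
  "min_percolating_size \<A> n \<longleftrightarrow>
     (\<exists>S. percolates \<A> S \<and> finite S \<and> card S = n) \<and>
     (\<forall>S. percolates \<A> S \<and> finite S \<longrightarrow> n \<le> card S)"

end

theory Submission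
  imports Defs
begin

text \<open>
  Write \<open>n = Max A - Min A\<close>. A run of \<open>n\<close> consecutive integers grows by one at each end in every
  step, so it percolates. Conversely, consider the integer functions \<open>f\<close> whose sum over every
  translate of \<open>A\<close> vanishes. Such an \<open>f\<close> can be prescribed arbitrarily on \<open>{0..<n}\<close>, whereas
  if \<open>f\<close> is even on a percolating seed, then it is even everywhere, because a point completing a
  translate of \<open>A\<close> inherits its parity from the other points of the translate. Hence, modulo 2, the
  \<open>2 ^ n\<close> choices on \<open>{0..<n}\<close> embed into the \<open>2 ^ card S\<close> parity patterns on a seed \<open>S\<close>.
\<close>

lemma occupied_0 [simp]: "occupied \<A> S 0 = S"
  by (simp add: occupied_def)

lemma occupied_Suc [simp]: "occupied \<A> S (Suc k) = perc_step \<A> (occupied \<A> S k)"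
  by (simp add: occupied_def)

lemma perc_step_increasing: "X \<subseteq> perc_step \<A> X"
  by (auto simp: perc_step_def)

lemma mem_perc_stepI:
  assumes "A \<in> \<A>" "b \<in> A" "\<And>a. a \<in> A \<Longrightarrow> a \<noteq> b \<Longrightarrow> a + v \<in> X"
  shows "b + v \<in> perc_step \<A> X"
proof (cases "b + v \<in> X")
  case True
  then show ?thesis using perc_step_increasing by blast
next
  case False
  with assms have "completes X (b + v) ((\<lambda>a. a + v) ` A)"
    by (auto simp: completes_def)
  with assms(1) show ?thesis by (auto simp: perc_step_def)
qed

lemma percolates_interval:
  fixes A :: "int set"
  assumes A: "A \<subseteq> {l..u}" "l \<in> A" "u \<in> A"
  shows "percolates {A} {0..<u - l}"
proof -
  have grow: "{- int k..<u - l + int k} \<subseteq> occupied {A} {0..<u - l} k" for k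
  proof (induction k)
    case 0
    then show ?case by simp
  next
    case (Suc k)
    let ?X = "occupied {A} {0..<u - l} k"
    \<comment> \<open>This shift puts \<open>u\<close> just right of the run and the rest of
      \<open>A\<close> inside it; the shift used further down does the same with \<open>l\<close> on
      the left.\<close>
    have "u + (int k - l) \<in> perc_step {A} ?X"
    proof (rule mem_perc_stepI)
      fix a assume "a \<in> A" "a \<noteq> u"
      then have "a + (int k - l) \<in> {- int k..<u - l + int k}"
        using subsetD[OF A(1) \<open>a \<in> A\<close>] by simp
      then show "a + (int k - l) \<in> ?X" using Suc by blast
    qed (use A in simp_all)
    moreover have "l + (- 1 - int k - l) \<in> perc_step {A} ?X"
    proof (rule mem_perc_stepI)
      fix a assume "a \<in> A" "a \<noteq> l"
      then have "a + (- 1 - int k - l) \<in> {- int k..<u - l + int k}"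
        using subsetD[OF A(1) \<open>a \<in> A\<close>] by simp
      then show "a + (- 1 - int k - l) \<in> ?X" using Suc by blast
    qed (use A in simp_all)
    ultimately have ends: "u - l + int k \<in> perc_step {A} ?X" "- 1 - int k \<in> perc_step {A} ?X"
      by (simp_all add: algebra_simps)
    show ?case
    proof
      fix x assume "x \<in> {- int (Suc k)..<u - l + int (Suc k)}"
      then consider "x = u - l + int k" | "x = - 1 - int k" | "x \<in> {- int k..<u - l + int k}"
        by fastforce
      then show "x \<in> occupied {A} {0..<u - l} (Suc k)"
        using ends Suc perc_step_increasing[of ?X "{A}"] by cases auto
    qed
  qed
  have "l \<le> u" using A by auto
  \<comment> \<open>The \<open>+ 1\<close> serves the strict upper bound, since \<open>l = u\<close>
    is allowed here.\<close>
  then have "x \<in> {- int (nat (\<bar>x\<bar> + 1))..<u - l + int (nat (\<bar>x\<bar> + 1))}" for x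
    by auto
  then show ?thesis
    unfolding percolates_def using grow by blast
qed

text \<open>
  The function that equals \<open>g\<close> on \<open>{0..<u - l}\<close> and sums to zero over every translate of \<open>A\<close>,
  where \<open>l\<close> and \<open>u\<close> are the least and greatest elements of \<open>A\<close>: outside the interval, solve for the
  extreme point of the translate.
\<close>

function null_ext :: "int set \<Rightarrow> int \<Rightarrow> int \<Rightarrow> (int \<Rightarrow> int) \<Rightarrow> int \<Rightarrow> int" where
  "null_ext A l u g k =
     (if k < 0 then - (\<Sum>a\<in>A \<inter> {l<..u}. null_ext A l u g (k - l + a))
      else if k < u - l then g k
      else - (\<Sum>a\<in>A \<inter> {l..<u}. null_ext A l u g (k - u + a)))"
  by auto
termination
  \<comment> \<open>For \<open>k < 0\<close> the calls may reach nonnegative arguments, but none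
    above \<open>k + (u - l)\<close>; the offset ranks every negative \<open>k\<close> above those.
    In the last branch they stay in \<open>{0..<k}\<close>.\<close>
  by (relation "Wellfounded.measure (\<lambda>(A, l, u, g, k). nat (if k < 0 then \<bar>u - l\<bar> - k else k))") auto

declare null_ext.simps [simp del]

lemma null_ext_interval: "0 \<le> k \<Longrightarrow> k < u - l \<Longrightarrow> null_ext A l u g k = g k"
  by (simp add: null_ext.simps)

text \<open>A translate of \<open>A\<close> does not fit into \<open>{0..<u - l}\<close>: either
  \<open>l + v < 0\<close> or \<open>u + v \<ge> u - l\<close>. At that end the recursive equation
  is the claim.\<close>

lemma sum_null_ext:
  fixes A :: "int set"
  assumes A: "A \<subseteq> {l..u}" "l \<in> A" "u \<in> A"
  shows "(\<Sum>a\<in>A. null_ext A l u g (a + v)) = 0"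
proof -
  let ?f = "null_ext A l u g"
  have fin: "finite A" using A(1) finite_subset by blast
  show ?thesis
  proof (cases "l + v < 0")
    case True
    have "A - {l} = A \<inter> {l<..u}" using A by force
    then have "(\<Sum>a\<in>A. ?f (a + v)) = ?f (l + v) + (\<Sum>a\<in>A \<inter> {l<..u}. ?f (a + v))"
      using sum.remove[OF fin A(2), of "\<lambda>a. ?f (a + v)"] by simp
    moreover have "?f (l + v) = - (\<Sum>a\<in>A \<inter> {l<..u}. ?f (a + v))"
      using True by (subst null_ext.simps) (simp add: algebra_simps)
    ultimately show ?thesis by simp
  next
    case False
    have "l \<le> u" using A by auto
    have "A - {u} = A \<inter> {l..<u}" using A by force
    then have "(\<Sum>a\<in>A. ?f (a + v)) = ?f (u + v) + (\<Sum>a\<in>A \<inter> {l..<u}. ?f (a + v))"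
      using sum.remove[OF fin A(3), of "\<lambda>a. ?f (a + v)"] by simp
    moreover have "?f (u + v) = - (\<Sum>a\<in>A \<inter> {l..<u}. ?f (a + v))"
      using False \<open>l \<le> u\<close> by (subst null_ext.simps) (simp add: algebra_simps)
    ultimately show ?thesis by simp
  qed
qed

text \<open>Induction on time: the other points of the translate completed by \<open>x\<close> are
  occupied earlier, so the even sum leaves \<open>h x\<close> even.\<close>

lemma percolates_even_everywhere:
  fixes h :: "'a::ab_group_add \<Rightarrow> int"
  assumes perc: "percolates {A} S" and fin: "finite A"
    and sums: "\<And>v. even (\<Sum>a\<in>A. h (a + v))"
    and seed: "\<And>s. s \<in> S \<Longrightarrow> even (h s)"
  shows "even (h x)"
proof -
  have "even (h x)" if "x \<in> occupied {A} S k" for k x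
    using that
  proof (induction k arbitrary: x)
    case 0
    then show ?case using seed by simp
  next
    case (Suc k)
    let ?X = "occupied {A} S k"
    from Suc.prems consider "x \<in> ?X" | v where "completes ?X x ((\<lambda>a. a + v) ` A)"
      by (auto simp: perc_step_def)
    then show ?case
    proof cases
      case 1
      then show ?thesis by (rule Suc.IH)
    next
      case 2
      then obtain b where b: "b \<in> A" "x = b + v"
        unfolding completes_def by blast
      have "a + v \<in> ?X" if "a \<in> A - {b}" for a
      proof -
        have "a + v \<in> (\<lambda>a. a + v) ` A" "a + v \<noteq> x"
          using that b(2) by simp_all
        with 2 show ?thesis unfolding completes_def by blast
      qed
      then have "even (\<Sum>a\<in>A - {b}. h (a + v))"
        by (intro dvd_sum Suc.IH)
      moreover have "(\<Sum>a\<in>A. h (a + v)) = h x + (\<Sum>a\<in>A - {b}. h (a + v))"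
        using sum.remove[OF fin b(1)] b(2) by simp
      ultimately show ?thesis using sums[of v] by simp
    qed
  qed
  then show ?thesis using perc unfolding percolates_def by blast
qed

lemma card_percolating_ge:
  fixes A :: "int set"
  assumes A: "A \<subseteq> {l..u}" "l \<in> A" "u \<in> A"
    and perc: "percolates {A} S" and finS: "finite S"
  shows "nat (u - l) \<le> card S"
proof -
  define F where "F T = null_ext A l u (\<lambda>k. of_bool (k \<in> T))" for T
  have finA: "finite A" using A(1) finite_subset by blast
  have "inj_on (\<lambda>T. {s \<in> S. odd (F T s)}) (Pow {0..<u - l})"
  proof (rule inj_onI)
    fix T U
    assume T: "T \<in> Pow {0..<u - l}" and U: "U \<in> Pow {0..<u - l}"
      and eq: "{s \<in> S. odd (F T s)} = {s \<in> S. odd (F U s)}"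
    \<comment> \<open>Vanishing sums persist under differences, and by \<open>eq\<close> this
      difference is even on \<open>S\<close>.\<close>
    have even_diff: "even (F T k - F U k)" for k
    proof (rule percolates_even_everywhere[where h = "\<lambda>k. F T k - F U k", OF perc finA])
      show "even (\<Sum>a\<in>A. F T (a + v) - F U (a + v))" for v
        by (simp add: F_def sum_subtractf sum_null_ext[OF A])
      show "even (F T s - F U s)" if "s \<in> S" for s
        using eq that by auto
    qed
    \<comment> \<open>On the interval both values are 0 or 1, so an even difference makes them
      equal.\<close>
    have "k \<in> T \<longleftrightarrow> k \<in> U" if "k \<in> {0..<u - l}" for k
      using that even_diff[of k] by (simp add: F_def null_ext_interval of_bool_def split: if_splits)
    with T U show "T = U" by blast
  qed
  then have "card (Pow {0..<u - l}) \<le> card (Pow S)"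
    by (rule card_inj_on_le) (use finS in auto)
  then show ?thesis
    using finS by (simp add: card_Pow)
qed

lemma convex_hull_eq_interval:
  fixes X :: "real set"
  assumes "X \<subseteq> {a..b}" "a \<in> X" "b \<in> X"
  shows "convex hull X = {a..b}"
proof
  show "convex hull X \<subseteq> {a..b}"
    using assms(1) by (simp add: hull_minimal)
  have "convex hull {a, b} \<subseteq> convex hull X"
    using assms by (intro hull_mono) auto
  then show "{a..b} \<subseteq> convex hull X"
    using assms by (auto simp: segment_convex_hull[symmetric] closed_segment_eq_real_ivl)
qed

theorem theorem1:
  fixes A :: "int set"
  assumes "finite A" and "card A \<ge> 2"
  shows "\<exists>n. min_percolating_size {A} n \<and>
             real n = measure lebesgue (convex hull (real_of_int ` A)) \<and>
             real n = real_of_int (Max A - Min A)"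
proof -
  define l u where "l = Min A" and "u = Max A"
  have "A \<noteq> {}" using assms by auto
  then have A: "A \<subseteq> {l..u}" "l \<in> A" "u \<in> A"
    using assms(1) by (auto simp: l_def u_def)
  then have "l \<le> u" by auto
  have "min_percolating_size {A} (nat (u - l))"
    unfolding min_percolating_size_def
    using percolates_interval[OF A] card_percolating_ge[OF A] by fastforce
  moreover have "convex hull (real_of_int ` A) = {real_of_int l..real_of_int u}"
    using A by (intro convex_hull_eq_interval) auto
  ultimately show ?thesis
    using \<open>l \<le> u\<close> by (intro exI[of _ "nat (u - l)"]) (simp add: l_def u_def)
qed

end
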